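(* Let $A$ be a vector space. Then the collection $\{\Theta_n\}_{n\ge1}$ of maps $\Theta_n:\mathrm{Hom}(\mathbb K[C_n]\otimes A^{\otimes n},A)\to\mathrm{Hom}(A^{\otimes n},A)$ defined by $$\Theta_n(f)=\begin{cases}f_{[1]}&\text{if }n=1,\\ f_{[1]}+\cdots+f_{[n]}+f_{[n+1]}&\text{if }n\ge2,\end{cases}$$ is a morphism of non-symmetric operads from the operad $\mathcal O_A=\{\mathrm{Hom}(\mathbb K[C_n]\otimes A^{\otimes n},A)\}_{n\ge1}$ to the endomorphism operad $\mathrm{End}_A=\{\mathrm{Hom}(A^{\otimes n},A)\}_{n\ge1}$.
   Context: All vector spaces and linear maps are over a field $\mathbb K$ of characteristic $0$. $C_1=\{[1]\}$ and $C_n=\{[1],\ldots,[n],[n+1]\}$ for $n\ge2$; $\mathbb K[C_n]$ is the vector space with basis $C_n$. For $f\in\mathcal O_A(n)=\mathrm{Hom}(\mathbb K[C_n]\otimes A^{\otimes n},A)$, $f_{[r]}=f([r];-)\in\mathrm{Hom}(A^{\otimes n},A)$, extended linearly in the first argument. Convention for arity one: for $f\in\mathcal O_A(1)$, $f([2];\cdot)$ is read as $0$. The non-symmetric operad structure on $\mathcal O_A$ has identity $\mathrm{id}([1];a)=a$ and the following partial compositions. For $f\in\mathcal O_A(m)$, $g\in\mathcal O_A(n)$, $1\le i\le m$ and $[r]\in C_{m+n-1}$, write $g_{s}=g(s;a_i,\ldots,a_{i+n-1})$ for $s\in\mathbb K[C_n]$ and $\Sigma=[1]+\cdots+[n+1]$.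 Then $(f\circ_ig)([r];a_1,\ldots,a_{m+n-1})$ equals - $f([r];a_1,\ldots,a_{i-1},g_{\Sigma},a_{i+n},\ldots,a_{m+n-1})$ if $1\le r\le i-1$; - $f([i];a_1,\ldots,a_{i-1},g_{[r-i+1]},a_{i+n},\ldots,a_{m+n-1})$ if $i\le r\le i+n-1$; - $f([r-n+1];a_1,\ldots,a_{i-1},g_{\Sigma},a_{i+n},\ldots,a_{m+n-1})$ if $i+n\le r\le m+n-1$; - $f([i];a_1,\ldots,a_{i-1},g_{[n+1]},a_{i+n},\ldots,a_{m+n-1})+f([m+1];a_1,\ldots,a_{i-1},g_{\Sigma},a_{i+n},\ldots,a_{m+n-1})$ if $r=m+n$ (this case occurring only when $m+n-1\ge2$). The endomorphism operad has partial compositions $f\circ_ig=f(\mathrm{id}^{\otimes i-1}\otimes g\otimes\mathrm{id}^{\otimes m-i})$ and identity $\mathrm{id}_A$. A morphism of non-symmetric operads satisfies $\Theta_{m+n-1}(f\circ_ig)=\Theta_m(f)\circ_i\Theta_n(g)$ and $\Theta_1(\mathrm{id})=\mathrm{id}_A$. *)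

theory Defs
  imports Complex_Main "HOL-Library.Poly_Mapping" "HOL-Library.Function_Algebras"
begin

section \<open>Linear non-symmetric operads\<close>

text \<open>
  The components \<open>P n\<close> (\<open>n \<ge> 1\<close>) are vector spaces, realised as subspaces of one ambient vector
  space. Since an element does not determine its arity, the partial composition
  \<open>f \<circ>\<^sub>i g\<close> of \<open>f \<in> P m\<close> and \<open>g \<in> P n\<close> takes both arities as arguments:
  it is written \<open>pcomp m n i f g\<close>. Nothing is required of \<open>P 0\<close>.
\<close>

locale ns_operad = vector_space scale
  for scale :: "'k::field \<Rightarrow> 'p::ab_group_add \<Rightarrow> 'p" +
  fixes P :: "nat \<Rightarrow> 'p set"
    and pcomp :: "nat \<Rightarrow> nat \<Rightarrow> nat \<Rightarrow> 'p \<Rightarrow> 'p \<Rightarrow> 'p"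
    and ident :: 'p
  assumes subspace_component: "1 \<le> n \<Longrightarrow> subspace (P n)"
    and pcomp_closed:
      "\<lbrakk>1 \<le> i; i \<le> m; 1 \<le> n; f \<in> P m; g \<in> P n\<rbrakk> \<Longrightarrow> pcomp m n i f g \<in> P (m + n - 1)"
    and pcomp_add_left:
      "\<lbrakk>1 \<le> i; i \<le> m; 1 \<le> n; f \<in> P m; f' \<in> P m; g \<in> P n\<rbrakk>
        \<Longrightarrow> pcomp m n i (f + f') g = pcomp m n i f g + pcomp m n i f' g"
    and pcomp_add_right:
      "\<lbrakk>1 \<le> i; i \<le> m; 1 \<le> n; f \<in> P m; g \<in> P n; g' \<in> P n\<rbrakk>
        \<Longrightarrow> pcomp m n i f (g + g') = pcomp m n i f g + pcomp m n i f g'"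
    and pcomp_scale_left:
      "\<lbrakk>1 \<le> i; i \<le> m; 1 \<le> n; f \<in> P m; g \<in> P n\<rbrakk>
        \<Longrightarrow> pcomp m n i (scale c f) g = scale c (pcomp m n i f g)"
    and pcomp_scale_right:
      "\<lbrakk>1 \<le> i; i \<le> m; 1 \<le> n; f \<in> P m; g \<in> P n\<rbrakk>
        \<Longrightarrow> pcomp m n i f (scale c g) = scale c (pcomp m n i f g)"
    and sequential_assoc:
      "\<lbrakk>1 \<le> i; i \<le> m; 1 \<le> j; j \<le> n; 1 \<le> l; f \<in> P m; g \<in> P n; h \<in> P l\<rbrakk>
        \<Longrightarrow> pcomp (m + n - 1) l (i + j - 1) (pcomp m n i f g) h
            = pcomp m (n + l - 1) i f (pcomp n l j g h)"
    and parallel_assoc: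
      "\<lbrakk>1 \<le> i; i < j; j \<le> m; 1 \<le> n; 1 \<le> l; f \<in> P m; g \<in> P n; h \<in> P l\<rbrakk>
        \<Longrightarrow> pcomp (m + n - 1) l (j + n - 1) (pcomp m n i f g) h
            = pcomp (m + l - 1) n i (pcomp m l j f h) g"
    and ident_closed: "ident \<in> P 1"
    and ident_left: "\<lbrakk>1 \<le> n; g \<in> P n\<rbrakk> \<Longrightarrow> pcomp 1 n 1 ident g = g"
    and ident_right: "\<lbrakk>1 \<le> i; i \<le> m; f \<in> P m\<rbrakk> \<Longrightarrow> pcomp m 1 i f ident = f"

locale ns_operad_morphism =
  src: ns_operad scaleP P compP identP + tgt: ns_operad scaleQ Q compQ identQ
  for scaleP :: "'k::field \<Rightarrow> 'p::ab_group_add \<Rightarrow> 'p" and P compP identP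
    and scaleQ :: "'k \<Rightarrow> 'q::ab_group_add \<Rightarrow> 'q" and Q compQ identQ +
  fixes \<Theta> :: "nat \<Rightarrow> 'p \<Rightarrow> 'q"
  assumes maps_component: "\<lbrakk>1 \<le> n; f \<in> P n\<rbrakk> \<Longrightarrow> \<Theta> n f \<in> Q n"
    and map_add: "\<lbrakk>1 \<le> n; f \<in> P n; g \<in> P n\<rbrakk> \<Longrightarrow> \<Theta> n (f + g) = \<Theta> n f + \<Theta> n g"
    and map_scale: "\<lbrakk>1 \<le> n; f \<in> P n\<rbrakk> \<Longrightarrow> \<Theta> n (scaleP c f) = scaleQ c (\<Theta> n f)"
    and map_pcomp:
      "\<lbrakk>1 \<le> i; i \<le> m; 1 \<le> n; f \<in> P m; g \<in> P n\<rbrakk>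
        \<Longrightarrow> \<Theta> (m + n - 1) (compP m n i f g) = compQ m n i (\<Theta> m f) (\<Theta> n g)"
    and map_ident: "\<Theta> 1 identP = identQ"


section \<open>The endomorphism operad\<close>

text \<open>
  A linear map out of a tensor power is given by the multilinear map of its values on pure
  tensors. \<open>End_A scale n\<close>, that is Hom of the \<open>n\<close>-th tensor power of \<open>A\<close> into \<open>A\<close>, thus consists
  of the \<open>n\<close>-linear maps, with the arguments \<open>a\<^sub>1, \<dots>, a\<^sub>n\<close> collected in a list of length \<open>n\<close>;
  the value on lists of any other length is fixed to be \<open>0\<close>, so that equality of elements is
  equality of functions. Here \<open>A\<close> is the whole type \<open>'a\<close> with scalar multiplication \<open>scale\<close>.
\<close>

definition End_A :: "('k::field \<Rightarrow> 'a::ab_group_add \<Rightarrow> 'a) \<Rightarrow> nat \<Rightarrow> ('a list \<Rightarrow> 'a) set" where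
  "End_A scale n =
    {f. (\<forall>xs. length xs = n \<longrightarrow>
            (\<forall>k<n. Vector_Spaces.linear scale scale (\<lambda>x. f (xs[k := x])))) \<and>
        (\<forall>xs. length xs \<noteq> n \<longrightarrow> f xs = 0)}"

definition End_scale :: "('k \<Rightarrow> 'a \<Rightarrow> 'a) \<Rightarrow> 'k \<Rightarrow> ('a list \<Rightarrow> 'a) \<Rightarrow> 'a list \<Rightarrow> 'a" where
  "End_scale scale c f = (\<lambda>xs. scale c (f xs))"

text \<open>
  \<open>insert_at n i f g\<close> sends \<open>a\<^sub>1, a\<^sub>2, \<dots>\<close> to
  \<open>f(a\<^sub>1, \<dots>, a\<^bsub>i-1\<^esub>, g(a\<^sub>i, \<dots>, a\<^bsub>i+n-1\<^esub>), a\<^bsub>i+n\<^esub>, \<dots>)\<close>.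
\<close>

definition insert_at :: "nat \<Rightarrow> nat \<Rightarrow> ('a list \<Rightarrow> 'a) \<Rightarrow> ('a list \<Rightarrow> 'a) \<Rightarrow> 'a list \<Rightarrow> 'a" where
  "insert_at n i f g xs =
    f (take (i - 1) xs @ [g (take n (drop (i - 1) xs))] @ drop (i - 1 + n) xs)"

definition End_comp ::
  "nat \<Rightarrow> nat \<Rightarrow> nat \<Rightarrow> ('a list \<Rightarrow> 'a) \<Rightarrow> ('a list \<Rightarrow> 'a) \<Rightarrow> 'a list \<Rightarrow> 'a" where
  "End_comp m n i f g = insert_at n i f g"

definition End_ident :: "'a::zero list \<Rightarrow> 'a" where
  "End_ident xs = (if length xs = 1 then xs ! 0 else 0)"


section \<open>The operad \<open>\<O>\<^sub>A\<close>\<close>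

text \<open>The basis element \<open>[r]\<close> is represented by the number \<open>r\<close>.\<close>

definition C :: "nat \<Rightarrow> nat set" where
  "C n = (if n = 1 then {1} else {1..n + 1})"

text \<open>
  \<open>KC n\<close> is the vector space with basis \<open>C n\<close>: formal linear combinations are finitely
  supported functions, and \<open>[r]\<close> becomes \<open>Poly_Mapping.single r 1\<close>.
\<close>

definition KC :: "nat \<Rightarrow> (nat \<Rightarrow>\<^sub>0 'k::field) set" where
  "KC n = {s. Poly_Mapping.keys s \<subseteq> C n}"

definition KC_scale :: "'k::field \<Rightarrow> (nat \<Rightarrow>\<^sub>0 'k) \<Rightarrow> (nat \<Rightarrow>\<^sub>0 'k)" where
  "KC_scale c s = Poly_Mapping.map (\<lambda>x. c * x) s"

text \<open>
  As for \<open>End_A\<close>, linear maps out of the tensor product of \<open>KC n\<close> with the \<open>n\<close>-th tensor power of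
  \<open>A\<close> are the maps \<open>f(s; a\<^sub>1, \<dots>, a\<^sub>n)\<close> linear in \<open>s \<in> KC n\<close> and in each \<open>a\<^sub>k\<close>,
  made zero outside their domain.
\<close>

definition O_A ::
  "('k::field \<Rightarrow> 'a::ab_group_add \<Rightarrow> 'a) \<Rightarrow> nat \<Rightarrow> ((nat \<Rightarrow>\<^sub>0 'k) \<Rightarrow> 'a list \<Rightarrow> 'a) set" where
  "O_A scale n =
    {f. (\<forall>s\<in>KC n. f s \<in> End_A scale n) \<and>
        (\<forall>s\<in>KC n. \<forall>t\<in>KC n. \<forall>xs. f (s + t) xs = f s xs + f t xs) \<and>
        (\<forall>c. \<forall>s\<in>KC n. \<forall>xs. f (KC_scale c s) xs = scale c (f s xs)) \<and>
        (\<forall>s. s \<notin> KC n \<longrightarrow> f s = 0)}"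

definition O_scale ::
  "('k::field \<Rightarrow> 'a \<Rightarrow> 'a) \<Rightarrow> 'k \<Rightarrow> ((nat \<Rightarrow>\<^sub>0 'k) \<Rightarrow> 'a list \<Rightarrow> 'a)
    \<Rightarrow> (nat \<Rightarrow>\<^sub>0 'k) \<Rightarrow> 'a list \<Rightarrow> 'a" where
  "O_scale scale c f = (\<lambda>s xs. scale c (f s xs))"

text \<open>
  \<open>ev n f r\<close> is \<open>f\<^bsub>[r]\<^esub>\<close> for \<open>f\<close> of arity \<open>n\<close>; the second case is the convention that
  \<open>f([2]; _)\<close> is \<open>0\<close> in arity one. \<open>ev_sum n f\<close> is the value of \<open>f\<close> at \<open>[1] + \<dots> + [n + 1]\<close>.
\<close>

definition ev ::
  "nat \<Rightarrow> ((nat \<Rightarrow>\<^sub>0 'k::field) \<Rightarrow> 'a list \<Rightarrow> 'a::ab_group_add) \<Rightarrow> nat \<Rightarrow> 'a list \<Rightarrow> 'a" where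
  "ev n f r = (if r \<in> C n then f (Poly_Mapping.single r 1) else 0)"

definition ev_sum ::
  "nat \<Rightarrow> ((nat \<Rightarrow>\<^sub>0 'k::field) \<Rightarrow> 'a list \<Rightarrow> 'a::ab_group_add) \<Rightarrow> 'a list \<Rightarrow> 'a" where
  "ev_sum n f = (\<Sum>r = 1..n + 1. ev n f r)"

definition O_comp_basis ::
  "nat \<Rightarrow> nat \<Rightarrow> nat \<Rightarrow> ((nat \<Rightarrow>\<^sub>0 'k::field) \<Rightarrow> 'a list \<Rightarrow> 'a::ab_group_add)
    \<Rightarrow> ((nat \<Rightarrow>\<^sub>0 'k) \<Rightarrow> 'a list \<Rightarrow> 'a) \<Rightarrow> nat \<Rightarrow> 'a list \<Rightarrow> 'a" where
  "O_comp_basis m n i f g r =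
    (if r \<le> i - 1 then insert_at n i (ev m f r) (ev_sum n g)
     else if r \<le> i + n - 1 then insert_at n i (ev m f i) (ev n g (r - i + 1))
     else if r \<le> m + n - 1 then insert_at n i (ev m f (r - n + 1)) (ev_sum n g)
     else insert_at n i (ev m f i) (ev n g (n + 1))
          + insert_at n i (ev m f (m + 1)) (ev_sum n g))"

definition O_comp ::
  "('k::field \<Rightarrow> 'a::ab_group_add \<Rightarrow> 'a) \<Rightarrow> nat \<Rightarrow> nat \<Rightarrow> nat
    \<Rightarrow> ((nat \<Rightarrow>\<^sub>0 'k) \<Rightarrow> 'a list \<Rightarrow> 'a) \<Rightarrow> ((nat \<Rightarrow>\<^sub>0 'k) \<Rightarrow> 'a list \<Rightarrow> 'a)
    \<Rightarrow> (nat \<Rightarrow>\<^sub>0 'k) \<Rightarrow> 'a list \<Rightarrow> 'a" where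
  "O_comp scale m n i f g s xs =
    (if s \<in> KC (m + n - 1)
     then \<Sum>r\<in>C (m + n - 1). scale (Poly_Mapping.lookup s r) (O_comp_basis m n i f g r xs)
     else 0)"

text \<open>The element of arity one with \<open>id([1]; a) = a\<close>.\<close>

definition O_ident ::
  "('k::field \<Rightarrow> 'a::ab_group_add \<Rightarrow> 'a) \<Rightarrow> (nat \<Rightarrow>\<^sub>0 'k) \<Rightarrow> 'a list \<Rightarrow> 'a" where
  "O_ident scale s xs =
    (if s \<in> KC 1 \<and> length xs = 1 then scale (Poly_Mapping.lookup s 1) (xs ! 0) else 0)"

definition Theta ::
  "nat \<Rightarrow> ((nat \<Rightarrow>\<^sub>0 'k::field) \<Rightarrow> 'a list \<Rightarrow> 'a::ab_group_add) \<Rightarrow> 'a list \<Rightarrow> 'a" where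
  "Theta n f = (if n = 1 then ev n f 1 else (\<Sum>r = 1..n. ev n f r) + ev n f (n + 1))"

end

theory Submission imports Defs begin

text \<open>
  An element \<open>f\<close> of \<open>\<O>\<^sub>A\<close> of arity \<open>n\<close> is the same as the family of multilinear maps
  \<open>f\<^bsub>[1]\<^esub>, \<dots>, f\<^bsub>[n+1]\<^esub>\<close>, and \<open>\<Theta>\<close> is the sum of the family. Summing the defining clauses of
  \<open>f \<circ>\<^sub>i g\<close> over all \<open>r\<close>, the second clause together with the first half of the last one gives
  \<open>f\<^bsub>[i]\<^esub> \<circ>\<^sub>i \<Theta>(g)\<close>, and the rest gives \<open>f\<^bsub>[r]\<^esub> \<circ>\<^sub>i \<Theta>(g)\<close> for \<open>r \<noteq> i\<close>, so \<open>\<Theta>\<close> is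
  multiplicative. With this, each component of the associativity laws of \<open>\<O>\<^sub>A\<close> reduces to the
  same law in the endomorphism operad.
\<close>

section \<open>The endomorphism operad\<close>

lemma sum_fun_apply: "sum F R x = (\<Sum>r\<in>R. F r x)"
  by (induction R rule: infinite_finite_induct) simp_all

text \<open>The pieces are the index ranges of a composition at input \<open>i\<close>: before the
  block, the block reindexed by the \<open>n\<close> inputs of the inner map, the later inputs
  \<open>r\<close> of the outer map shifted by \<open>n - 1\<close>, and the top index
  \<open>m + n\<close>.\<close>

lemma sum_split_block:
  fixes e :: "nat \<Rightarrow> 'a::comm_monoid_add"
  assumes "1 \<le> i" "i \<le> m"
  shows "sum e {1..m + n} = sum e {1..<i} + ((\<Sum>s = 1..n. e (i + s - 1)) +
    ((\<Sum>r\<in>{i<..m}. e (r + n - 1)) + e (m + n)))"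
proof -
  have "sum e {1..m + n} = sum e {1..<m + n} + e (m + n)"
    using assms by (subst sum.last_plus) (auto simp: add.commute)
  also have "sum e {1..<m + n} = sum e {1..<i} + sum e {i..<i + n} + sum e {i + n..<m + n}"
    using assms by (simp add: sum.atLeastLessThan_concat)
  also have "sum e {i..<i + n} = (\<Sum>s = 1..n. e (i + s - 1))"
    by (rule sum.reindex_bij_witness[of _ "\<lambda>s. i + s - 1" "\<lambda>r. r + 1 - i"]) (use assms in auto)
  also have "sum e {i + n..<m + n} = (\<Sum>r\<in>{i<..m}. e (r + n - 1))"
    by (rule sum.reindex_bij_witness[of _ "\<lambda>r. r + n - 1" "\<lambda>r. r + 1 - n"]) (use assms in auto)
  finally show ?thesis by (simp add: add.assoc)
qed

text \<open>The case of a block of size one. It cuts the sum over the components of the outer map in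
  the same pattern, so that the two sums can be compared piece by piece.\<close>

lemma sum_split_at:
  fixes e :: "nat \<Rightarrow> 'a::comm_monoid_add"
  assumes "1 \<le> i" "i \<le> m"
  shows "sum e {1..m + 1} = sum e {1..<i} + (e i + (sum e {i<..m} + e (m + 1)))"
  using sum_split_block[OF assms, of e 1] by simp

section \<open>Insertion on lists cut around a block\<close>

text \<open>Once the argument list is cut around the block, insertions are evaluated by rewriting,
  without arithmetic on \<open>take\<close> and \<open>drop\<close>.\<close>

lemma insert_at_append:
  assumes "length us = i - 1" "length vs = n"
  shows "insert_at n i f g (us @ vs @ ws) = f (us @ g vs # ws)"
  using assms by (simp add: insert_at_def)

lemma insert_at_add_left: "insert_at n i (f + f') g = insert_at n i f g + insert_at n i f' g"
  by (simp add: insert_at_def fun_eq_iff)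

lemma insert_at_zero_left: "insert_at n i 0 g = 0"
  by (simp add: insert_at_def fun_eq_iff)

lemma insert_at_sum_left: "insert_at n i (sum F R) g = (\<Sum>r\<in>R. insert_at n i (F r) g)"
  by (simp add: insert_at_def fun_eq_iff sum_fun_apply)

text \<open>Produces the cuts that \<open>insert_at_append\<close> consumes.\<close>

lemma split_list_block:
  assumes "length zs = m + n - 1" "1 \<le> i" "i \<le> m"
  obtains us vs ws where "zs = us @ vs @ ws" "length us = i - 1" "length vs = n" "length ws = m - i"
  using assms
  by (intro that[of "take (i - 1) zs" "take n (drop (i - 1) zs)" "drop n (drop (i - 1) zs)"])
    (auto simp flip: drop_drop)

section \<open>Multilinear maps as functions on lists\<close>

context vector_space
begin

lemma linear_self_iff:
  "Vector_Spaces.linear scale scale f \<longleftrightarrow>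
    (\<forall>a b. f (a + b) = f a + f b) \<and> (\<forall>c a. f (scale c a) = scale c (f a))"
  using vector_space_axioms by (auto simp: Vector_Spaces.linear_iff)

text \<open>Decompositions \<open>us @ a # ws\<close> are easier to rewrite than list updates. The
  additivity and scaling clauses carry no length condition, since on a list of the wrong length all
  values involved are \<open>0\<close> and the equations hold trivially.\<close>

lemma End_A_iff:
  "f \<in> End_A scale n \<longleftrightarrow>
    (\<forall>us a b ws. f (us @ (a + b) # ws) = f (us @ a # ws) + f (us @ b # ws)) \<and>
    (\<forall>us c a ws. f (us @ scale c a # ws) = scale c (f (us @ a # ws))) \<and>
    (\<forall>xs. length xs \<noteq> n \<longrightarrow> f xs = 0)" (is "_ = ?R")
proof
  assume f: "f \<in> End_A scale n"
  have zero: "f xs = 0" if "length xs \<noteq> n" for xs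
    using f that by (auto simp: End_A_def)
  have lin: "Vector_Spaces.linear scale scale (\<lambda>x. f (us @ x # ws))"
    if "length us + length ws + 1 = n" for us ws
  proof -
    \<comment> \<open>The entry \<open>0\<close> is a placeholder, overwritten by the update at
      position \<open>length us\<close>.\<close>
    have "Vector_Spaces.linear scale scale (\<lambda>x. f ((us @ 0 # ws)[length us := x]))"
      using f that unfolding End_A_def by (auto simp del: list_update_length)
    then show ?thesis by simp
  qed
  have "f (us @ (a + b) # ws) = f (us @ a # ws) + f (us @ b # ws) \<and>
      f (us @ scale c a # ws) = scale c (f (us @ a # ws))" for us a b c ws
    using lin[of us ws] zero
    by (cases "length us + length ws + 1 = n") (auto simp: linear_self_iff)
  then show ?R using zero by blast
next
  assume R: ?R
  have "Vector_Spaces.linear scale scale (\<lambda>x. f (xs[k := x]))" if "k < length xs" for xs k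
    using R that by (simp add: linear_self_iff upd_conv_take_nth_drop)
  with R show "f \<in> End_A scale n" by (simp add: End_A_def)
qed

lemma End_A_add:
  "f \<in> End_A scale n \<Longrightarrow> f (us @ (a + b) # ws) = f (us @ a # ws) + f (us @ b # ws)"
  by (simp add: End_A_iff)

lemma End_A_scale:
  "f \<in> End_A scale n \<Longrightarrow> f (us @ scale c a # ws) = scale c (f (us @ a # ws))"
  by (simp add: End_A_iff)

lemma End_A_zero: "f \<in> End_A scale n \<Longrightarrow> f (us @ 0 # ws) = 0"
  using End_A_scale[of f n us 0 0 ws] by simp

lemma End_A_length: "\<lbrakk>f \<in> End_A scale n; length xs \<noteq> n\<rbrakk> \<Longrightarrow> f xs = 0"
  by (simp add: End_A_iff)

lemma End_A_eqI:
  assumes "f \<in> End_A scale n" "g \<in> End_A scale n" "\<And>xs. length xs = n \<Longrightarrow> f xs = g xs"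
  shows "f = g"
  using assms by (metis End_A_length ext)

lemma End_A_closed_zero: "0 \<in> End_A scale n"
  by (simp add: End_A_iff)

lemma End_A_closed_add: "\<lbrakk>f \<in> End_A scale n; g \<in> End_A scale n\<rbrakk> \<Longrightarrow> f + g \<in> End_A scale n"
  by (simp add: End_A_iff scale_right_distrib)

lemma End_A_closed_scale: "f \<in> End_A scale n \<Longrightarrow> (\<lambda>xs. scale c (f xs)) \<in> End_A scale n"
  by (simp add: End_A_iff scale_right_distrib mult.commute)

lemma End_A_closed_sum:
  "(\<And>r. r \<in> R \<Longrightarrow> F r \<in> End_A scale n) \<Longrightarrow> sum F R \<in> End_A scale n"
  by (induction R rule: infinite_finite_induct)
    (simp_all add: End_A_closed_zero End_A_closed_add del: zero_fun_apply plus_fun_apply)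

lemma insert_at_add_right:
  assumes "f \<in> End_A scale m"
  shows "insert_at n i f (g + g') = insert_at n i f g + insert_at n i f g'"
  using End_A_add[OF assms] by (simp add: insert_at_def fun_eq_iff)

lemma insert_at_zero_right: "f \<in> End_A scale m \<Longrightarrow> insert_at n i f 0 = 0"
  by (simp add: insert_at_def fun_eq_iff End_A_zero)

lemma insert_at_scale_right:
  "f \<in> End_A scale m \<Longrightarrow>
    insert_at n i f (\<lambda>xs. scale c (g xs)) = (\<lambda>xs. scale c (insert_at n i f g xs))"
  by (simp add: insert_at_def fun_eq_iff End_A_scale)

lemma End_A_sum:
  "f \<in> End_A scale n \<Longrightarrow> f (us @ sum a R # ws) = (\<Sum>r\<in>R. f (us @ a r # ws))"
  by (induction R rule: infinite_finite_induct) (simp_all add: End_A_zero End_A_add)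

lemma insert_at_sum_right:
  "f \<in> End_A scale m \<Longrightarrow> insert_at n i f (sum G R) = (\<Sum>r\<in>R. insert_at n i f (G r))"
  by (simp add: insert_at_def fun_eq_iff sum_fun_apply End_A_sum)

lemma insert_at_closed:
  assumes i: "1 \<le> i" "i \<le> m" and n: "1 \<le> n"
    and f: "f \<in> End_A scale m" and g: "g \<in> End_A scale n"
  shows "insert_at n i f g \<in> End_A scale (m + n - 1)"
proof -
  have len: "insert_at n i f g xs = 0" if "length xs \<noteq> m + n - 1" for xs
  proof (cases "length xs < i - 1 + n")
    \<comment> \<open>The list is too short to fill the block, so \<open>g\<close> receives fewer
      than \<open>n\<close> arguments and vanishes; then \<open>f\<close> vanishes because one of
      its arguments is \<open>0\<close>.\<close>
    case True
    then have "g (take n (drop (i - 1) xs)) = 0"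
      using n by (intro End_A_length[OF g]) simp
    then show ?thesis by (simp add: insert_at_def End_A_zero[OF f])
  next
    case False
    then show ?thesis
      using that i unfolding insert_at_def by (intro End_A_length[OF f]) auto
  qed
  have lin: "insert_at n i f g (us @ (a + b) # ws) =
        insert_at n i f g (us @ a # ws) + insert_at n i f g (us @ b # ws) \<and>
      insert_at n i f g (us @ scale c a # ws) = scale c (insert_at n i f g (us @ a # ws))"
    if l: "length us + length ws + 1 = m + n - 1" for us ws a b c
  proof -
    \<comment> \<open>The varied argument lies before, inside or after the block. In the outer cases
      linearity of \<open>f\<close> suffices; inside the block linearity of \<open>g\<close> is used
      first.\<close>
    consider "length us < i - 1" | "i - 1 \<le> length us" "length us < i - 1 + n"
      | "i - 1 + n \<le> length us" by linarith
    then show ?thesis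
    proof cases
      case 1
      \<comment> \<open>\<open>p\<close> counts the arguments strictly between the varied one and
        the block.\<close>
      define p where "p = i - 2 - length us"
      have "i - 1 - length us = Suc p" "i - 1 + n - length us = Suc (p + n)"
        using 1 by (auto simp: p_def)
      then have "insert_at n i f g (us @ x # ws) =
          f (us @ x # (take p ws @ g (take n (drop p ws)) # drop (p + n) ws))" for x
        by (simp add: insert_at_def)
      then show ?thesis using f by (simp add: End_A_add End_A_scale)
    next
      case 2
      \<comment> \<open>Here \<open>p\<close> counts the arguments of the block to the right of the
        varied one; \<open>us2\<close> holds those to its left.\<close>
      define p where "p = i - 1 + n - length us - 1"
      define us1 us2 where "us1 = take (i - 1) us" "us2 = drop (i - 1) us"
      have us: "us = us1 @ us2" "length us1 = i - 1" using 2 by (auto simp: us1_us2_def)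
      have "length (us2 @ x # take p ws) = n" for x
        using 2 l us i by (auto simp: p_def)
      then have "insert_at n i f g (us1 @ (us2 @ x # take p ws) @ drop p ws) =
          f (us1 @ g (us2 @ x # take p ws) # drop p ws)" for x
        using us by (intro insert_at_append) auto
      then have "insert_at n i f g (us @ x # ws) =
          f (us1 @ g (us2 @ x # take p ws) # drop p ws)" for x
        by (simp add: us)
      then show ?thesis using f g by (simp add: End_A_add End_A_scale)
    next
      case 3
      define us1 us2 us3 where "us1 = take (i - 1) us" "us2 = take n (drop (i - 1) us)"
        "us3 = drop (i - 1 + n) us"
      have "us = us1 @ us2 @ us3"
        by (metis append_take_drop_id drop_drop add.commute us1_us2_us3_def)
      moreover have "length us1 = i - 1" "length us2 = n"
        using 3 by (auto simp: us1_us2_us3_def)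
      ultimately have "insert_at n i f g (us @ x # ws) = f ((us1 @ g us2 # us3) @ x # ws)" for x
        by (simp add: insert_at_append)
      then show ?thesis by (simp only: End_A_add[OF f] End_A_scale[OF f])
    qed
  qed
  show ?thesis
    unfolding End_A_iff
  proof (intro conjI allI impI)
    fix us ws a b c
    show "insert_at n i f g (us @ (a + b) # ws) =
        insert_at n i f g (us @ a # ws) + insert_at n i f g (us @ b # ws)"
      using lin[of us ws] len by (cases "length us + length ws + 1 = m + n - 1") auto
    show "insert_at n i f g (us @ scale c a # ws) = scale c (insert_at n i f g (us @ a # ws))"
      using lin[of us ws] len by (cases "length us + length ws + 1 = m + n - 1") auto
  qed (fact len)
qed

section \<open>Associativity and unit laws of insertion\<close>

text \<open>By \<open>End_A_eqI\<close> only lists of full length matter, and these can be cut as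
  \<open>us @ (ps @ qs @ rs) @ ws\<close>. Both sides then evaluate to
  \<open>f (us @ g (ps @ h qs # rs) # ws)\<close>.\<close>

lemma insert_at_sequential:
  assumes "1 \<le> i" "i \<le> m" "1 \<le> j" "j \<le> n" "1 \<le> l"
    and f: "f \<in> End_A scale m" and g: "g \<in> End_A scale n" and h: "h \<in> End_A scale l"
  shows "insert_at l (i + j - 1) (insert_at n i f g) h
    = insert_at (n + l - 1) i f (insert_at l j g h)"
proof (rule End_A_eqI)
  show "insert_at l (i + j - 1) (insert_at n i f g) h \<in> End_A scale (m + n + l - 2)"
    using insert_at_closed[OF _ _ _ insert_at_closed[OF _ _ _ f g] h, of "i + j - 1" i] assms
    by (simp add: numeral_2_eq_2)
  show "insert_at (n + l - 1) i f (insert_at l j g h) \<in> End_A scale (m + n + l - 2)"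
    using insert_at_closed[OF _ _ _ f insert_at_closed[OF _ _ _ g h], of i j] assms
    by (simp add: numeral_2_eq_2 add.assoc)
  fix xs :: "'b list" assume "length xs = m + n + l - 2"
  then have "length xs = m + (n + l - 1) - 1" using assms by simp
  then obtain us vs ws where xs: "xs = us @ vs @ ws" "length us = i - 1" "length vs = n + l - 1"
      "length ws = m - i"
    using assms(1,2) by (rule split_list_block)
  from xs(3) assms(3,4) obtain ps qs rs where vs: "vs = ps @ qs @ rs" "length ps = j - 1"
      "length qs = l" "length rs = n - j"
    by (rule split_list_block)
  have "insert_at l (i + j - 1) (insert_at n i f g) h ((us @ ps) @ qs @ (rs @ ws)) =
      insert_at n i f g ((us @ ps) @ h qs # rs @ ws)"
    using xs vs assms by (intro insert_at_append) auto
  also have "\<dots> = insert_at n i f g (us @ (ps @ h qs # rs) @ ws)" by simp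
  also have "\<dots> = f (us @ g (ps @ h qs # rs) # ws)"
    using xs vs assms by (intro insert_at_append) auto
  also have "\<dots> = f (us @ insert_at l j g h vs # ws)"
    using vs by (simp add: insert_at_append)
  also have "\<dots> = insert_at (n + l - 1) i f (insert_at l j g h) xs"
    unfolding xs(1) by (intro insert_at_append[symmetric] xs)
  finally show "insert_at l (i + j - 1) (insert_at n i f g) h xs =
      insert_at (n + l - 1) i f (insert_at l j g h) xs"
    by (simp add: xs vs)
qed

text \<open>Both sides evaluate to \<open>f (us @ g vs # ps @ h qs # rs)\<close>. As
  \<open>i < j\<close>, inserting \<open>g\<close> first moves the position of \<open>h\<close> by
  \<open>n - 1\<close>, whereas inserting \<open>h\<close> first leaves that of \<open>g\<close>
  unchanged.\<close>

lemma insert_at_parallel: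
  assumes "1 \<le> i" "i < j" "j \<le> m" "1 \<le> n" "1 \<le> l"
    and f: "f \<in> End_A scale m" and g: "g \<in> End_A scale n" and h: "h \<in> End_A scale l"
  shows "insert_at l (j + n - 1) (insert_at n i f g) h = insert_at n i (insert_at l j f h) g"
proof (rule End_A_eqI)
  show "insert_at l (j + n - 1) (insert_at n i f g) h \<in> End_A scale (m + n + l - 2)"
    using insert_at_closed[OF _ _ _ insert_at_closed[OF _ _ _ f g] h, of "j + n - 1" i] assms
    by (simp add: numeral_2_eq_2)
  show "insert_at n i (insert_at l j f h) g \<in> End_A scale (m + n + l - 2)"
    using insert_at_closed[OF _ _ _ insert_at_closed[OF _ _ _ f h] g, of i j] assms
    by (simp add: numeral_2_eq_2 ac_simps)
  fix xs :: "'b list" assume "length xs = m + n + l - 2"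
  then have "length xs = (m + l - 1) + n - 1" using assms by simp
  then obtain us vs ts where xs: "xs = us @ vs @ ts" "length us = i - 1" "length vs = n"
      "length ts = (m - i) + l - 1"
    using assms by (elim split_list_block[where i = i]) auto
  \<comment> \<open>Counted from the end of the block of \<open>g\<close>, the map \<open>h\<close>
    feeds input \<open>j - i\<close> among the remaining \<open>m - i\<close> inputs of
    \<open>f\<close>.\<close>
  then obtain ps qs rs where ts: "ts = ps @ qs @ rs" "length ps = j - i - 1" "length qs = l"
    using assms by (elim split_list_block[where i = "j - i"]) auto
  have "insert_at l (j + n - 1) (insert_at n i f g) h ((us @ vs @ ps) @ qs @ rs) =
      insert_at n i f g ((us @ vs @ ps) @ h qs # rs)"
    using xs ts assms by (intro insert_at_append) auto
  also have "\<dots> = f (us @ g vs # ps @ h qs # rs)"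
    using xs by (simp add: insert_at_append)
  also have "\<dots> = insert_at l j f h ((us @ g vs # ps) @ qs @ rs)"
    using xs ts assms by (subst insert_at_append) auto
  also have "\<dots> = insert_at n i (insert_at l j f h) g xs"
    using xs ts by (simp add: insert_at_append)
  finally show "insert_at l (j + n - 1) (insert_at n i f g) h xs =
      insert_at n i (insert_at l j f h) g xs"
    by (simp add: xs ts)
qed

lemma End_ident_closed: "End_ident \<in> End_A scale 1"
  by (auto simp: End_A_iff End_ident_def append_eq_Cons_conv length_Suc_conv)

lemma insert_at_ident_left:
  assumes "g \<in> End_A scale n" "1 \<le> n"
  shows "insert_at n 1 End_ident g = g"
proof (rule End_A_eqI[OF _ assms(1)])
  show "insert_at n 1 End_ident g \<in> End_A scale n"
    using insert_at_closed[OF _ _ _ End_ident_closed assms(1), of 1] assms(2) by simp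
qed (simp add: insert_at_def End_ident_def)

lemma insert_at_ident_right:
  assumes "f \<in> End_A scale m" "1 \<le> i" "i \<le> m"
  shows "insert_at 1 i f End_ident = f"
proof (rule End_A_eqI[OF _ assms(1)])
  show "insert_at 1 i f End_ident \<in> End_A scale m"
    using insert_at_closed[OF _ _ _ assms(1) End_ident_closed] assms by simp
  fix xs :: "'b list" assume "length xs = m"
  with assms show "insert_at 1 i f End_ident xs = f xs"
    by (cases i) (simp_all add: insert_at_def End_ident_def id_take_nth_drop[symmetric])
qed

lemma vector_space_End_scale: "vector_space (End_scale scale)"
  by unfold_locales (simp_all add: End_scale_def fun_eq_iff scale_right_distrib scale_left_distrib)

lemma ns_operad_End: "ns_operad (End_scale scale) (End_A scale) End_comp End_ident"
proof -
  interpret E: vector_space "End_scale scale" by (fact vector_space_End_scale)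
  show ?thesis
  proof unfold_locales
    show "E.subspace (End_A scale n)" for n
      unfolding E.subspace_def End_scale_def
      by (metis End_A_closed_zero End_A_closed_add End_A_closed_scale)
  next
    fix i m j n l :: nat and f g h
    assume "1 \<le> i" "i \<le> m" "1 \<le> j" "j \<le> n" "1 \<le> l"
      "f \<in> End_A scale m" "g \<in> End_A scale n" "h \<in> End_A scale l"
    then show "End_comp (m + n - 1) l (i + j - 1) (End_comp m n i f g) h =
        End_comp m (n + l - 1) i f (End_comp n l j g h)"
      by (simp only: End_comp_def insert_at_sequential)
  next
    fix i m j n l :: nat and f g h
    assume "1 \<le> i" "i < j" "j \<le> m" "1 \<le> n" "1 \<le> l"
      "f \<in> End_A scale m" "g \<in> End_A scale n" "h \<in> End_A scale l"
    then show "End_comp (m + n - 1) l (j + n - 1) (End_comp m n i f g) h =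
        End_comp (m + l - 1) n i (End_comp m l j f h) g"
      by (simp only: End_comp_def insert_at_parallel)
  next
    fix i m n :: nat and f f' g :: "'b list \<Rightarrow> 'b"
    show "End_comp m n i (f + f') g = End_comp m n i f g + End_comp m n i f' g"
      by (simp only: End_comp_def insert_at_add_left)
  next
    fix i m n :: nat and f g g'
    assume "f \<in> End_A scale m"
    then show "End_comp m n i f (g + g') = End_comp m n i f g + End_comp m n i f g'"
      by (simp only: End_comp_def insert_at_add_right)
  next
    fix i m n :: nat and f g c
    assume "f \<in> End_A scale m"
    then show "End_comp m n i f (End_scale scale c g) = End_scale scale c (End_comp m n i f g)"
      by (simp add: End_comp_def End_scale_def insert_at_scale_right)
  next
    fix i m n :: nat and f g c
    show "End_comp m n i (End_scale scale c f) g = End_scale scale c (End_comp m n i f g)"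
      by (simp add: End_comp_def End_scale_def insert_at_def fun_eq_iff)
  qed (simp_all add: End_comp_def insert_at_closed End_ident_closed insert_at_ident_left
      insert_at_ident_right del: One_nat_def)
qed


end

section \<open>The operad \<open>\<O>\<^sub>A\<close>\<close>

lemma finite_C: "finite (C n)"
  by (simp add: C_def)

lemma C_bounds: "r \<in> C n \<Longrightarrow> 1 \<le> r \<and> r \<le> n + 1"
  by (auto simp: C_def split: if_splits)

lemma zero_in_KC: "0 \<in> KC n"
  by (simp add: KC_def)

lemma single_in_KC: "r \<in> C n \<Longrightarrow> Poly_Mapping.single r c \<in> KC n"
  by (simp add: KC_def)

lemma add_in_KC: "\<lbrakk>s \<in> KC n; t \<in> KC n\<rbrakk> \<Longrightarrow> s + t \<in> KC n"
  unfolding KC_def using Poly_Mapping.keys_add[of s t] by blast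

lemma lookup_KC_scale:
  "Poly_Mapping.lookup (KC_scale c s) r = c * Poly_Mapping.lookup s r"
  by (simp add: KC_scale_def Poly_Mapping.map.rep_eq when_def)

lemma KC_scale_in_KC: "s \<in> KC n \<Longrightarrow> KC_scale c s \<in> KC n"
  by (auto simp: KC_def in_keys_iff lookup_KC_scale)

lemma KC_scale_zero: "KC_scale 0 s = 0"
  by (simp add: poly_mapping_eq_iff fun_eq_iff lookup_KC_scale)

lemma sum_in_KC: "(\<And>r. r \<in> R \<Longrightarrow> s r \<in> KC n) \<Longrightarrow> sum s R \<in> KC n"
  by (induction R rule: infinite_finite_induct) (simp_all add: zero_in_KC add_in_KC)

lemma KC_expand:
  assumes "s \<in> KC n"
  shows "s = (\<Sum>r\<in>C n. KC_scale (Poly_Mapping.lookup s r) (Poly_Mapping.single r 1))"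
proof (rule poly_mapping_eqI)
  fix k
  have "Poly_Mapping.lookup (\<Sum>r\<in>C n. KC_scale (Poly_Mapping.lookup s r) (Poly_Mapping.single r 1)) k
      = (\<Sum>r\<in>C n. if r = k then Poly_Mapping.lookup s k else 0)"
    by (intro trans[OF Poly_Mapping.lookup_sum] sum.cong)
      (auto simp: lookup_KC_scale lookup_single)
  also have "\<dots> = Poly_Mapping.lookup s k"
    using assms finite_C by (auto simp: KC_def in_keys_iff)
  finally show "Poly_Mapping.lookup s k =
      Poly_Mapping.lookup (\<Sum>r\<in>C n. KC_scale (Poly_Mapping.lookup s r) (Poly_Mapping.single r 1)) k"
    by simp
qed

section \<open>Components and their sum\<close>

lemma ev_add: "ev n (f + g) r = ev n f r + ev n g r"
  by (simp add: ev_def fun_eq_iff)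

lemma ev_scale: "vector_space scale \<Longrightarrow> ev n (O_scale scale c f) r = End_scale scale c (ev n f r)"
  by (simp add: ev_def O_scale_def End_scale_def fun_eq_iff module.scale_zero_right
      flip: module_iff_vector_space)

lemma ev_sum_add: "ev_sum n (f + g) = ev_sum n f + ev_sum n g"
  by (simp add: ev_sum_def ev_add sum.distrib del: plus_fun_apply)

text \<open>In arity one the term at \<open>[2]\<close> is \<open>0\<close> by the convention built
  into \<open>ev\<close>, so both cases of \<open>Theta\<close> are the same sum.\<close>

lemma Theta_eq_ev_sum: "1 \<le> n \<Longrightarrow> Theta n f = ev_sum n f"
  by (auto simp: Theta_def ev_sum_def ev_def C_def numeral_2_eq_2)

text \<open>The linear extension of a family of maps from the basis \<open>C n\<close> to
  \<open>KC n\<close>. On \<open>O_A\<close> it inverts the passage from \<open>f\<close> to its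
  components, and both \<open>O_comp\<close> and \<open>O_ident\<close> have this form.\<close>

definition O_of ::
  "('k::field \<Rightarrow> 'a::ab_group_add \<Rightarrow> 'a) \<Rightarrow> nat \<Rightarrow> (nat \<Rightarrow> 'a list \<Rightarrow> 'a)
    \<Rightarrow> (nat \<Rightarrow>\<^sub>0 'k) \<Rightarrow> 'a list \<Rightarrow> 'a" where
  "O_of scale n F s xs =
    (if s \<in> KC n then \<Sum>r\<in>C n. scale (Poly_Mapping.lookup s r) (F r xs) else 0)"

section \<open>Elements of \<open>O_A\<close> as families of multilinear maps\<close>

context vector_space
begin

lemma O_of_closed:
  assumes "\<And>r. r \<in> C n \<Longrightarrow> F r \<in> End_A scale n"
  shows "O_of scale n F \<in> O_A scale n"
proof -
  have "(\<Sum>r\<in>C n. (\<lambda>xs. scale (Poly_Mapping.lookup s r) (F r xs))) \<in> End_A scale n" for s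
    using assms by (intro End_A_closed_sum End_A_closed_scale)
  then have "O_of scale n F s \<in> End_A scale n" if "s \<in> KC n" for s
    using that by (simp add: O_of_def[abs_def] sum_fun_apply[abs_def])
  then show ?thesis
    unfolding O_A_def
    by (auto simp: O_of_def add_in_KC KC_scale_in_KC lookup_add lookup_KC_scale
        scale_left_distrib sum.distrib scale_sum_right fun_eq_iff)
qed

lemma ev_O_of: "r \<in> C n \<Longrightarrow> ev n (O_of scale n F) r = F r"
  using finite_C[of n]
  by (simp add: ev_def O_of_def fun_eq_iff single_in_KC lookup_single when_def if_distrib[of "\<lambda>c. scale c _"]
      cong: if_cong)

text \<open>On \<open>KC n\<close> this is the basis expansion \<open>KC_expand\<close> together
  with linearity of \<open>f\<close> in its first argument; elsewhere both sides are
  \<open>0\<close>.\<close>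

lemma O_A_expand:
  assumes f: "f \<in> O_A scale n"
  shows "f = O_of scale n (ev n f)"
proof (intro ext)
  fix s xs
  have add: "f (s + t) xs = f s xs + f t xs" if "s \<in> KC n" "t \<in> KC n" for s t
    using f that by (simp add: O_A_def)
  have scl: "f (KC_scale c s) xs = scale c (f s xs)" if "s \<in> KC n" for s c
    using f that by (simp add: O_A_def)
  \<comment> \<open>The empty sum in the induction below needs this value; it comes from scaling by
    \<open>0\<close>.\<close>
  have zero: "f 0 xs = 0"
    using scl[OF zero_in_KC, of 0] by (simp add: KC_scale_zero)
  have sum: "f (sum t R) xs = (\<Sum>r\<in>R. f (t r) xs)" if "\<And>r. r \<in> R \<Longrightarrow> t r \<in> KC n" for t and R :: "nat set"
    using that
    by (induction R rule: infinite_finite_induct) (simp_all add: zero add sum_in_KC)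
  show "f s xs = O_of scale n (ev n f) s xs"
  proof (cases "s \<in> KC n")
    case True
    have "f s xs = (\<Sum>r\<in>C n. f (KC_scale (Poly_Mapping.lookup s r) (Poly_Mapping.single r 1)) xs)"
      by (subst KC_expand[OF True]) (intro sum KC_scale_in_KC single_in_KC)
    also have "\<dots> = O_of scale n (ev n f) s xs"
      using True by (simp add: O_of_def ev_def scl single_in_KC)
    finally show ?thesis .
  next
    case False
    then show ?thesis using f by (simp add: O_A_def O_of_def)
  qed
qed

text \<open>Reduces every operad identity in \<open>O_A\<close> to identities between multilinear
  maps, one for each basis element.\<close>

lemma O_A_eqI:
  assumes "f \<in> O_A scale n" "g \<in> O_A scale n" "\<And>r. r \<in> C n \<Longrightarrow> ev n f r = ev n g r"
  shows "f = g"
proof -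
  have "O_of scale n (ev n f) = O_of scale n (ev n g)"
    using assms(3) by (simp add: O_of_def fun_eq_iff)
  then show ?thesis using assms(1,2) O_A_expand by metis
qed

lemma ev_closed: "f \<in> O_A scale n \<Longrightarrow> ev n f r \<in> End_A scale n"
  by (auto simp: ev_def O_A_def single_in_KC End_A_closed_zero simp del: zero_fun_apply)

lemma ev_sum_closed: "f \<in> O_A scale n \<Longrightarrow> ev_sum n f \<in> End_A scale n"
  unfolding ev_sum_def by (intro End_A_closed_sum ev_closed)

lemma ev_sum_scale: "ev_sum n (O_scale scale c f) = End_scale scale c (ev_sum n f)"
  by (simp add: ev_sum_def ev_scale[OF vector_space_axioms] End_scale_def sum_fun_apply
      scale_sum_right fun_eq_iff del: sum.cl_ivl_Suc)

section \<open>Composition and identity in terms of components\<close>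

lemma O_comp_eq_O_of: "O_comp scale m n i f g = O_of scale (m + n - 1) (O_comp_basis m n i f g)"
  by (simp add: O_comp_def O_of_def fun_eq_iff)

lemma O_ident_eq_O_of: "O_ident scale = O_of scale 1 (\<lambda>_. End_ident)"
  by (auto simp: O_ident_def O_of_def End_ident_def C_def fun_eq_iff)

lemma O_ident_closed: "O_ident scale \<in> O_A scale 1"
  unfolding O_ident_eq_O_of by (intro O_of_closed End_ident_closed)

lemma ev_O_ident: "ev 1 (O_ident scale) r = (if r = 1 then End_ident else 0)"
proof (cases "r = 1")
  case True
  then show ?thesis unfolding O_ident_eq_O_of by (subst ev_O_of) (auto simp: C_def)
next
  case False
  then show ?thesis by (simp add: ev_def C_def)
qed

lemma ev_sum_O_ident: "ev_sum 1 (O_ident scale) = End_ident"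
  unfolding ev_sum_def ev_O_ident by simp

lemma O_comp_basis_closed:
  assumes "1 \<le> i" "i \<le> m" "1 \<le> n" "f \<in> O_A scale m" "g \<in> O_A scale n"
  shows "O_comp_basis m n i f g r \<in> End_A scale (m + n - 1)"
  unfolding O_comp_basis_def
  using insert_at_closed[OF assms(1-3) ev_closed[OF assms(4)]] ev_closed[OF assms(5)]
    ev_sum_closed[OF assms(5)]
  by (auto intro: End_A_closed_add simp del: plus_fun_apply)

lemma O_comp_closed:
  assumes "1 \<le> i" "i \<le> m" "1 \<le> n" "f \<in> O_A scale m" "g \<in> O_A scale n"
  shows "O_comp scale m n i f g \<in> O_A scale (m + n - 1)"
  unfolding O_comp_eq_O_of by (intro O_of_closed O_comp_basis_closed assms)

text \<open>For \<open>m = n = 1\<close> the index \<open>r = 2\<close> is not in \<open>C 1\<close>, but the last clause of the composition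
  then yields \<open>0\<close>, in agreement with the convention for \<open>ev\<close>. This spares all later arguments a
  distinction of arities.\<close>

lemma ev_O_comp:
  assumes "1 \<le> i" "i \<le> m" "1 \<le> n" "f \<in> O_A scale m" "g \<in> O_A scale n" "1 \<le> r" "r \<le> m + n"
  shows "ev (m + n - 1) (O_comp scale m n i f g) r = O_comp_basis m n i f g r"
proof (cases "r \<in> C (m + n - 1)")
  case True
  then show ?thesis by (simp add: O_comp_eq_O_of ev_O_of)
next
  case False
  then have eq: "m = 1" "n = 1" "i = 1" "r = 2"
    using assms by (auto simp: C_def split: if_splits)
  \<comment> \<open>Of the two summands of the last clause, one has outer map \<open>0\<close> and
    vanishes at once. The other has inner map \<open>0\<close>, and its vanishing needs linearity of
    the outer map.\<close>
  have "insert_at 1 1 (ev 1 f 1) 0 = 0"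
    using assms eq by (intro insert_at_zero_right[OF ev_closed]) auto
  with False show ?thesis
    unfolding eq by (simp add: ev_def C_def O_comp_basis_def insert_at_zero_left del: zero_fun_apply)
qed

section \<open>The clauses of the composition and their sum\<close>

context
  fixes i m n :: nat and f g
  assumes i: "1 \<le> i" "i \<le> m" and n: "1 \<le> n" and f: "f \<in> O_A scale m" and g: "g \<in> O_A scale n"
begin

text \<open>This lemma and the next three reparametrize the clauses of \<open>O_comp_basis\<close>
  by the index at which \<open>f\<close> or \<open>g\<close> is evaluated, which removes the
  subtractions from the right-hand sides.\<close>

lemma ev_O_comp_before:
  "\<lbrakk>1 \<le> r; r < i\<rbrakk> \<Longrightarrow>
    ev (m + n - 1) (O_comp scale m n i f g) r = insert_at n i (ev m f r) (ev_sum n g)"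
  using i n by (subst ev_O_comp[OF i n f g]) (auto simp: O_comp_basis_def)

lemma ev_O_comp_block:
  "\<lbrakk>1 \<le> s; s \<le> n\<rbrakk> \<Longrightarrow>
    ev (m + n - 1) (O_comp scale m n i f g) (i + s - 1) = insert_at n i (ev m f i) (ev n g s)"
  using i n by (subst ev_O_comp[OF i n f g]) (auto simp: O_comp_basis_def Suc_diff_le)

lemma ev_O_comp_after:
  "\<lbrakk>i < r; r \<le> m\<rbrakk> \<Longrightarrow>
    ev (m + n - 1) (O_comp scale m n i f g) (r + n - 1) = insert_at n i (ev m f r) (ev_sum n g)"
  using i n by (subst ev_O_comp[OF i n f g]) (auto simp: O_comp_basis_def Suc_diff_le)

lemma ev_O_comp_top:
  "ev (m + n - 1) (O_comp scale m n i f g) (m + n) =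
    insert_at n i (ev m f i) (ev n g (n + 1)) + insert_at n i (ev m f (m + 1)) (ev_sum n g)"
  using i n by (subst ev_O_comp[OF i n f g]) (auto simp: O_comp_basis_def)

text \<open>Serves twice: as multiplicativity of \<open>Theta\<close>, and in sequential
  associativity, where \<open>f\<close> is combined with the full sum of the components of a
  composite.\<close>

lemma ev_sum_O_comp:
  "ev_sum (m + n - 1) (O_comp scale m n i f g) = insert_at n i (ev_sum m f) (ev_sum n g)"
proof -
  let ?e = "ev (m + n - 1) (O_comp scale m n i f g)" and ?I = "insert_at n i"
  have "ev_sum (m + n - 1) (O_comp scale m n i f g) = sum ?e {1..m + n}"
    using n by (simp add: ev_sum_def)
  also note sum_split_block[OF i]
  also have "sum ?e {1..<i} = (\<Sum>r = 1..<i. ?I (ev m f r) (ev_sum n g))"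
    by (intro sum.cong) (auto simp: ev_O_comp_before simp del: One_nat_def)
  also have "(\<Sum>s = 1..n. ?e (i + s - 1)) = (\<Sum>s = 1..n. ?I (ev m f i) (ev n g s))"
    by (intro sum.cong) (auto simp: ev_O_comp_block simp del: One_nat_def)
  also have "(\<Sum>r\<in>{i<..m}. ?e (r + n - 1)) = (\<Sum>r\<in>{i<..m}. ?I (ev m f r) (ev_sum n g))"
    by (intro sum.cong) (auto simp: ev_O_comp_after simp del: One_nat_def)
  also note ev_O_comp_top
  \<comment> \<open>Regrouping puts the first summand of the top clause next to the block sum. It
    supplies the missing term \<open>s = n + 1\<close>, so the two combine into an insertion of
    \<open>ev_sum n g\<close>.\<close>
  also have "(\<Sum>r = 1..<i. ?I (ev m f r) (ev_sum n g)) + ((\<Sum>s = 1..n. ?I (ev m f i) (ev n g s)) +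
      ((\<Sum>r\<in>{i<..m}. ?I (ev m f r) (ev_sum n g)) +
        (?I (ev m f i) (ev n g (n + 1)) + ?I (ev m f (m + 1)) (ev_sum n g)))) =
      (\<Sum>r = 1..<i. ?I (ev m f r) (ev_sum n g)) +
      ((\<Sum>s = 1..n. ?I (ev m f i) (ev n g s)) + ?I (ev m f i) (ev n g (n + 1))) +
      (\<Sum>r\<in>{i<..m}. ?I (ev m f r) (ev_sum n g)) + ?I (ev m f (m + 1)) (ev_sum n g)"
    by (simp only: add.assoc add.left_commute add.commute)
  also have "(\<Sum>s = 1..n. ?I (ev m f i) (ev n g s)) + ?I (ev m f i) (ev n g (n + 1)) =
      ?I (ev m f i) (ev_sum n g)"
    unfolding ev_sum_def insert_at_sum_right[OF ev_closed[OF f]] by simp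
  also have "(\<Sum>r = 1..<i. ?I (ev m f r) (ev_sum n g)) + ?I (ev m f i) (ev_sum n g) +
      (\<Sum>r\<in>{i<..m}. ?I (ev m f r) (ev_sum n g)) + ?I (ev m f (m + 1)) (ev_sum n g) =
      (\<Sum>r = 1..m + 1. ?I (ev m f r) (ev_sum n g))"
    using i by (simp only: sum_split_at[of i m] add.assoc)
  also have "\<dots> = ?I (ev_sum m f) (ev_sum n g)"
    by (simp only: insert_at_sum_left ev_sum_def[of m])
  finally show ?thesis .
qed

end

section \<open>Associativity in \<open>O_A\<close>\<close>

text \<open>For each index \<open>r\<close> the clauses turn both sides into double insertions of
  components of \<open>f\<close>, \<open>g\<close>, \<open>h\<close>, which
  \<open>insert_at_sequential\<close> identifies. Where the right-hand side involves the full sum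
  over the composite of \<open>g\<close> and \<open>h\<close>, \<open>ev_sum_O_comp\<close> resolves
  it.\<close>

lemma O_comp_sequential:
  assumes i: "1 \<le> i" "i \<le> m" and j: "1 \<le> j" "j \<le> n" and l: "1 \<le> l"
    and f: "f \<in> O_A scale m" and g: "g \<in> O_A scale n" and h: "h \<in> O_A scale l"
  shows "O_comp scale (m + n - 1) l (i + j - 1) (O_comp scale m n i f g) h =
    O_comp scale m (n + l - 1) i f (O_comp scale n l j g h)"
proof -
  define k where "k = i + j - 1"
  define fg where "fg = O_comp scale m n i f g"
  define gh where "gh = O_comp scale n l j g h"
  have n: "1 \<le> n" and nl: "1 \<le> n + l - 1" and k: "1 \<le> k" "k \<le> m + n - 1"
    using i j l by (auto simp: k_def)
  have fg: "fg \<in> O_A scale (m + n - 1)" and gh: "gh \<in> O_A scale (n + l - 1)"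
    unfolding fg_def gh_def by (intro O_comp_closed i j n l f g h)+
  \<comment> \<open>The two sides carry differently bracketed truncated subtractions; everything is
    rewritten to the form on the left.\<close>
  have arity: "m + (n + l - 1) - 1 = m + n - 1 + l - 1"
    using n l by simp
  note FG = ev_O_comp_before[OF i n f g, folded fg_def] ev_O_comp_block[OF i n f g, folded fg_def]
    ev_O_comp_after[OF i n f g, folded fg_def] ev_O_comp_top[OF i n f g, folded fg_def]
  note GH = ev_O_comp_before[OF j l g h, folded gh_def] ev_O_comp_block[OF j l g h, folded gh_def]
    ev_O_comp_after[OF j l g h, folded gh_def] ev_O_comp_top[OF j l g h, folded gh_def]
    ev_sum_O_comp[OF j l g h, folded gh_def]
  note L_before = ev_O_comp_before[OF k l fg h] and L_block = ev_O_comp_block[OF k l fg h]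
    and L_after = ev_O_comp_after[OF k l fg h] and L_top = ev_O_comp_top[OF k l fg h]
  note R_before = ev_O_comp_before[OF i nl f gh, unfolded arity]
    and R_block = ev_O_comp_block[OF i nl f gh, unfolded arity]
    and R_after = ev_O_comp_after[OF i nl f gh, unfolded arity]
    and R_top = ev_O_comp_top[OF i nl f gh, unfolded arity]
  note assoc = insert_at_sequential[OF i j l, folded k_def]
  note closed = ev_closed[OF f] ev_closed[OF g] ev_closed[OF h] ev_sum_closed[OF g] ev_sum_closed[OF h]
  have "O_comp scale (m + n - 1) l k fg h = O_comp scale m (n + l - 1) i f gh"
  proof (rule O_A_eqI)
    show "O_comp scale (m + n - 1) l k fg h \<in> O_A scale (m + n - 1 + l - 1)"
      by (intro O_comp_closed k l fg h)
    show "O_comp scale m (n + l - 1) i f gh \<in> O_A scale (m + n - 1 + l - 1)"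
      using O_comp_closed[OF i nl f gh] by (simp only: arity)
    fix r assume "r \<in> C (m + n - 1 + l - 1)"
    then have r: "1 \<le> r" "r \<le> m + n + l - 1" using C_bounds[of r] n l by fastforce+
    let ?L = "ev (m + n - 1 + l - 1) (O_comp scale (m + n - 1) l k fg h)"
    let ?R = "ev (m + n - 1 + l - 1) (O_comp scale m (n + l - 1) i f gh)"
    \<comment> \<open>In order: before \<open>g\<close>, inputs of \<open>g\<close> before
      \<open>h\<close>, inputs of \<open>h\<close>, inputs of \<open>g\<close> after
      \<open>h\<close>, inputs of \<open>f\<close> after \<open>g\<close>, and the top
      index.\<close>
    consider "r < i" | "i \<le> r" "r < k" | "k \<le> r" "r < k + l"
      | "k + l \<le> r" "r < i + n + l - 1" | "i + n + l - 1 \<le> r" "r < m + n + l - 1"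
      | "r = m + n + l - 1"
      using r by linarith
    then show "?L r = ?R r"
    proof cases
      case 1
      have "?L r = insert_at l k (insert_at n i (ev m f r) (ev_sum n g)) (ev_sum l h)"
        using 1 r j by (subst L_before) (auto simp: FG k_def simp del: One_nat_def)
      also have "\<dots> = ?R r"
        using 1 r by (simp add: R_before GH assoc closed del: One_nat_def)
      finally show ?thesis .
    next
      case 2
      define s where "s = r + 1 - i"
      have s: "1 \<le> s" "s < j" "s \<le> n" "r = i + s - 1"
        using 2 j by (auto simp: s_def k_def)
      have "?L r = insert_at l k (insert_at n i (ev m f i) (ev n g s)) (ev_sum l h)"
        using 2 r FG(2)[OF s(1,3)] by (simp add: L_before flip: s(4) del: One_nat_def)
      also have "\<dots> = insert_at (n + l - 1) i (ev m f i) (ev (n + l - 1) gh s)"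
        using s by (simp only: GH(1) assoc closed)
      also have "\<dots> = ?R r"
        unfolding s(4) using s l by (intro R_block[symmetric]) auto
      finally show ?thesis .
    next
      case 3
      define s where "s = r + 1 - k"
      have s: "1 \<le> s" "s \<le> l" "r = k + s - 1" "r = i + (j + s - 1) - 1"
        using 3 i j by (auto simp: s_def k_def)
      have "?L r = insert_at l k (insert_at n i (ev m f i) (ev n g j)) (ev l h s)"
        unfolding s(3) L_block[OF s(1,2)] using FG(2)[OF j] by (simp only: k_def)
      also have "\<dots> = insert_at (n + l - 1) i (ev m f i) (ev (n + l - 1) gh (j + s - 1))"
        using s by (simp only: GH(2) assoc closed)
      also have "\<dots> = ?R r"
        unfolding s(4) using s j by (intro R_block[symmetric]) auto
      finally show ?thesis .
    next
      case 4
      \<comment> \<open>\<open>s\<close> is the input of \<open>g\<close> behind \<open>r\<close>,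
        displaced by \<open>i - 1\<close> for its place in \<open>f\<close> and by
        \<open>l - 1\<close> for the block of \<open>h\<close>.\<close>
      define s where "s = r + 2 - i - l"
      have s: "j < s" "s \<le> n" "1 \<le> s" "r = (i + s - 1) + l - 1" "r = i + (s + l - 1) - 1"
        using 4 i j l by (auto simp: s_def k_def)
      have "?L r = insert_at l k (ev (m + n - 1) fg (i + s - 1)) (ev_sum l h)"
        unfolding s(4) using s i j by (intro L_after) (auto simp: k_def)
      also have "\<dots> = insert_at (n + l - 1) i (ev m f i) (ev (n + l - 1) gh (s + l - 1))"
        using s by (simp only: FG(2) GH(3) assoc closed)
      also have "\<dots> = ?R r"
        unfolding s(5) using s l by (intro R_block[symmetric]) auto
      finally show ?thesis .
    next
      case 5
      \<comment> \<open>\<open>s\<close> is now an input of \<open>f\<close>, displaced by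
        \<open>n - 1\<close> and by \<open>l - 1\<close>.\<close>
      define s where "s = r + 2 - n - l"
      have s: "i < s" "s \<le> m" "r = (s + n - 1) + l - 1" "r = s + (n + l - 1) - 1"
        using 5 i n l by (auto simp: s_def k_def)
      have "?L r = insert_at l k (ev (m + n - 1) fg (s + n - 1)) (ev_sum l h)"
        unfolding s(3) using s i j by (intro L_after) (auto simp: k_def)
      also have "\<dots> = insert_at (n + l - 1) i (ev m f s) (ev_sum (n + l - 1) gh)"
        using s by (simp only: FG(3) GH(5) assoc closed)
      also have "\<dots> = ?R r"
        unfolding s(4) using s by (intro R_after[symmetric]) auto
      finally show ?thesis .
    next
      case 6
      have eqs: "r = m + n - 1 + l" "r = m + (n + l - 1)" "m + n - 1 + 1 = m + n"
        "n + l - 1 + 1 = n + l"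
        using 6 n l by auto
      \<comment> \<open>The top clause splits twice on either side: on the left through the
        composite of \<open>f\<close> and \<open>g\<close>, on the right through that of
        \<open>g\<close> and \<open>h\<close>. The same three terms result, bracketed
        differently.\<close>
      have "?L r = insert_at l k (insert_at n i (ev m f i) (ev n g j)) (ev l h (l + 1)) +
          (insert_at l k (insert_at n i (ev m f i) (ev n g (n + 1))) (ev_sum l h) +
           insert_at l k (insert_at n i (ev m f (m + 1)) (ev_sum n g)) (ev_sum l h))"
        unfolding eqs(1) L_top eqs(3) FG(4) insert_at_add_left
        using FG(2)[OF j] by (simp only: k_def)
      also have "\<dots> = insert_at (n + l - 1) i (ev m f i) (ev (n + l - 1) gh (n + l)) +
          insert_at (n + l - 1) i (ev m f (m + 1)) (ev_sum (n + l - 1) gh)"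
        by (simp only: GH(4,5) assoc closed insert_at_add_right[OF ev_closed[OF f]] add.assoc)
      also have "\<dots> = ?R r"
        unfolding eqs(2) R_top eqs(4) ..
      finally show ?thesis .
    qed
  qed
  then show ?thesis by (simp only: k_def fg_def gh_def)
qed

text \<open>The same comparison, now with \<open>insert_at_parallel\<close>. Since \<open>g\<close>
  and \<open>h\<close> occupy different inputs of \<open>f\<close>, the full sum is only ever taken
  over \<open>g\<close> or \<open>h\<close> alone, never over a composite.\<close>

lemma O_comp_parallel:
  assumes i: "1 \<le> i" and ij: "i < j" and j: "j \<le> m" and n: "1 \<le> n" and l: "1 \<le> l"
    and f: "f \<in> O_A scale m" and g: "g \<in> O_A scale n" and h: "h \<in> O_A scale l"
  shows "O_comp scale (m + n - 1) l (j + n - 1) (O_comp scale m n i f g) h =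
    O_comp scale (m + l - 1) n i (O_comp scale m l j f h) g"
proof -
  define k where "k = j + n - 1"
  define fg where "fg = O_comp scale m n i f g"
  define fh where "fh = O_comp scale m l j f h"
  have im: "1 \<le> i" "i \<le> m" and jm: "1 \<le> j" "j \<le> m" and k: "1 \<le> k" "k \<le> m + n - 1"
    and iml: "1 \<le> i" "i \<le> m + l - 1"
    using i ij j n l by (auto simp: k_def)
  have fg: "fg \<in> O_A scale (m + n - 1)" and fh: "fh \<in> O_A scale (m + l - 1)"
    unfolding fg_def fh_def by (intro O_comp_closed im jm n l f g h)+
  have arity: "m + l - 1 + n - 1 = m + n - 1 + l - 1"
    using n l by simp
  note FG = ev_O_comp_before[OF im n f g, folded fg_def] ev_O_comp_block[OF im n f g, folded fg_def]
    ev_O_comp_after[OF im n f g, folded fg_def] ev_O_comp_top[OF im n f g, folded fg_def]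
  note FH = ev_O_comp_before[OF jm l f h, folded fh_def] ev_O_comp_block[OF jm l f h, folded fh_def]
    ev_O_comp_after[OF jm l f h, folded fh_def] ev_O_comp_top[OF jm l f h, folded fh_def]
  note L_before = ev_O_comp_before[OF k l fg h] and L_block = ev_O_comp_block[OF k l fg h]
    and L_after = ev_O_comp_after[OF k l fg h] and L_top = ev_O_comp_top[OF k l fg h]
  note R_before = ev_O_comp_before[OF iml n fh g, unfolded arity]
    and R_block = ev_O_comp_block[OF iml n fh g, unfolded arity]
    and R_after = ev_O_comp_after[OF iml n fh g, unfolded arity]
    and R_top = ev_O_comp_top[OF iml n fh g, unfolded arity]
  note assoc = insert_at_parallel[OF i ij j n l, folded k_def]
  note closed = ev_closed[OF f] ev_closed[OF g] ev_closed[OF h] ev_sum_closed[OF g] ev_sum_closed[OF h]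
  have "O_comp scale (m + n - 1) l k fg h = O_comp scale (m + l - 1) n i fh g"
  proof (rule O_A_eqI)
    show "O_comp scale (m + n - 1) l k fg h \<in> O_A scale (m + n - 1 + l - 1)"
      by (intro O_comp_closed k l fg h)
    show "O_comp scale (m + l - 1) n i fh g \<in> O_A scale (m + n - 1 + l - 1)"
      using O_comp_closed[OF iml n fh g] by (simp only: arity)
    fix r assume "r \<in> C (m + n - 1 + l - 1)"
    then have r: "1 \<le> r" "r \<le> m + n + l - 1" using C_bounds[of r] n l by fastforce+
    let ?L = "ev (m + n - 1 + l - 1) (O_comp scale (m + n - 1) l k fg h)"
    let ?R = "ev (m + n - 1 + l - 1) (O_comp scale (m + l - 1) n i fh g)"
    \<comment> \<open>In order: before \<open>g\<close>, inputs of \<open>g\<close>, between the two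
      blocks, inputs of \<open>h\<close>, after \<open>h\<close>, and the top index.\<close>
    consider "r < i" | "i \<le> r" "r < i + n" | "i + n \<le> r" "r < k" | "k \<le> r" "r < k + l"
      | "k + l \<le> r" "r < m + n + l - 1" | "r = m + n + l - 1"
      using r by linarith
    then show "?L r = ?R r"
    proof cases
      case 1
      have "?L r = insert_at l k (insert_at n i (ev m f r) (ev_sum n g)) (ev_sum l h)"
        using 1 r ij by (subst L_before) (auto simp: FG k_def simp del: One_nat_def)
      also have "\<dots> = ?R r"
        using 1 r ij by (simp add: R_before FH assoc closed del: One_nat_def)
      finally show ?thesis .
    next
      case 2
      define s where "s = r + 1 - i"
      have s: "1 \<le> s" "s \<le> n" "r = i + s - 1"
        using 2 by (auto simp: s_def)
      have "?L r = insert_at l k (ev (m + n - 1) fg (i + s - 1)) (ev_sum l h)"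
        unfolding s(3) using s i ij by (intro L_before) (auto simp: k_def)
      also have "\<dots> = insert_at n i (ev (m + l - 1) fh i) (ev n g s)"
        using s i ij by (simp only: FG(2) FH(1) assoc closed)
      also have "\<dots> = ?R r"
        unfolding s(3) using s by (intro R_block[symmetric]) auto
      finally show ?thesis .
    next
      case 3
      define s where "s = r + 1 - n"
      have s: "i < s" "s < j" "s \<le> m" "1 \<le> s" "r = s + n - 1"
        using 3 i j n by (auto simp: s_def k_def)
      have "?L r = insert_at l k (ev (m + n - 1) fg (s + n - 1)) (ev_sum l h)"
        unfolding s(5) using s n by (intro L_before) (auto simp: k_def)
      also have "\<dots> = insert_at n i (ev (m + l - 1) fh s) (ev_sum n g)"
        using s by (simp only: FG(3) FH(1) assoc closed)
      also have "\<dots> = ?R r"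
        unfolding s(5) using s l by (intro R_after[symmetric]) auto
      finally show ?thesis .
    next
      case 4
      define s where "s = r + 1 - k"
      have s: "1 \<le> s" "s \<le> l" "r = k + s - 1" "r = (j + s - 1) + n - 1"
        using 4 n jm by (auto simp: s_def k_def)
      have "?L r = insert_at l k (insert_at n i (ev m f j) (ev_sum n g)) (ev l h s)"
        unfolding s(3) L_block[OF s(1,2)] using FG(3)[OF ij j] by (simp only: k_def)
      also have "\<dots> = insert_at n i (ev (m + l - 1) fh (j + s - 1)) (ev_sum n g)"
        using s by (simp only: FH(2) assoc closed)
      also have "\<dots> = ?R r"
        unfolding s(4) using s ij j l by (intro R_after[symmetric]) auto
      finally show ?thesis .
    next
      case 5
      define s where "s = r + 2 - n - l"
      have s: "j < s" "i < s" "s \<le> m" "r = (s + n - 1) + l - 1" "r = (s + l - 1) + n - 1"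
        using 5 ij n l by (auto simp: s_def k_def)
      have "?L r = insert_at l k (ev (m + n - 1) fg (s + n - 1)) (ev_sum l h)"
        unfolding s(4) using s n by (intro L_after) (auto simp: k_def)
      also have "\<dots> = insert_at n i (ev (m + l - 1) fh (s + l - 1)) (ev_sum n g)"
        using s by (simp only: FG(3) FH(3) assoc closed)
      also have "\<dots> = ?R r"
        unfolding s(5) using s l by (intro R_after[symmetric]) auto
      finally show ?thesis .
    next
      case 6
      have eqs: "r = m + n - 1 + l" "r = m + l - 1 + n" "m + n - 1 + 1 = m + n"
        "m + l - 1 + 1 = m + l"
        using 6 n l by auto
      \<comment> \<open>Here the nested top clause comes from \<open>f\<close> with \<open>g\<close>
        on the left and from \<open>f\<close> with \<open>h\<close> on the right, so the first two
        of the three terms trade places.\<close>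
      have "?L r = insert_at l k (insert_at n i (ev m f j) (ev_sum n g)) (ev l h (l + 1)) +
          (insert_at l k (insert_at n i (ev m f i) (ev n g (n + 1))) (ev_sum l h) +
           insert_at l k (insert_at n i (ev m f (m + 1)) (ev_sum n g)) (ev_sum l h))"
        unfolding eqs(1) L_top eqs(3) FG(4) insert_at_add_left
        using FG(3)[OF ij j] by (simp only: k_def)
      also have "\<dots> = insert_at n i (ev (m + l - 1) fh i) (ev n g (n + 1)) +
          insert_at n i (ev (m + l - 1) fh (m + l)) (ev_sum n g)"
        using i ij
        by (simp only: FH(1,4) assoc closed insert_at_add_left add.left_commute)
      also have "\<dots> = ?R r"
        unfolding eqs(2) R_top eqs(4) ..
      finally show ?thesis .
    qed
  qed
  then show ?thesis by (simp only: k_def fg_def fh_def)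
qed

section \<open>Unit laws in \<open>O_A\<close>\<close>

lemma O_comp_ident_left:
  assumes n: "1 \<le> n" and g: "g \<in> O_A scale n"
  shows "O_comp scale 1 n 1 (O_ident scale) g = g"
proof (rule O_A_eqI[OF _ g])
  show "O_comp scale 1 n 1 (O_ident scale) g \<in> O_A scale n"
    using O_comp_closed[OF _ _ n O_ident_closed g, of 1] by simp
  fix r assume "r \<in> C n"
  then have r: "1 \<le> r" "r \<le> n + 1" using C_bounds by blast+
  then have "ev (1 + n - 1) (O_comp scale 1 n 1 (O_ident scale) g) r =
      O_comp_basis 1 n 1 (O_ident scale) g r"
    using n by (intro ev_O_comp O_ident_closed g) auto
  also have "\<dots> = ev n g r"
  proof (cases "r \<le> n")
    case True
    then show ?thesis
      using r insert_at_ident_left[OF ev_closed[OF g] n] ev_O_ident[of 1]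
      by (simp add: O_comp_basis_def)
  next
    case False
    \<comment> \<open>The identity vanishes at \<open>[2]\<close>, so the last clause leaves only
      the identity at \<open>[1]\<close> applied to \<open>ev n g (n + 1)\<close>.\<close>
    then have "r = n + 1" using r by simp
    then show ?thesis
      using insert_at_ident_left[OF ev_closed[OF g] n] ev_O_ident[of 1] ev_O_ident[of 2]
      by (simp add: O_comp_basis_def insert_at_zero_left numeral_2_eq_2)
  qed
  finally show "ev n (O_comp scale 1 n 1 (O_ident scale) g) r = ev n g r" by simp
qed

text \<open>Every clause up to \<open>m\<close> inserts \<open>End_ident\<close>, since both the
  component at \<open>[1]\<close> and the full sum of the identity equal it. At the top, the first
  summand has inner map \<open>0\<close> and the second yields
  \<open>ev m f (m + 1)\<close>.\<close>

lemma O_comp_ident_right: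
  assumes i: "1 \<le> i" "i \<le> m" and f: "f \<in> O_A scale m"
  shows "O_comp scale m 1 i f (O_ident scale) = f"
proof (rule O_A_eqI[OF _ f])
  show "O_comp scale m 1 i f (O_ident scale) \<in> O_A scale m"
    using O_comp_closed[OF i _ f O_ident_closed] by simp
  fix r assume "r \<in> C m"
  then have r: "1 \<le> r" "r \<le> m + 1" using C_bounds by blast+
  then have "ev (m + 1 - 1) (O_comp scale m 1 i f (O_ident scale)) r =
      O_comp_basis m 1 i f (O_ident scale) r"
    by (intro ev_O_comp O_ident_closed i f) auto
  also have "\<dots> = ev m f r"
  proof -
    have ident: "insert_at 1 i (ev m f q) End_ident = ev m f q" for q
      by (intro insert_at_ident_right[OF ev_closed[OF f]] i)
    have zero: "insert_at 1 i (ev m f i) 0 = 0"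
      by (rule insert_at_zero_right[OF ev_closed[OF f]])
    have "ev 1 (O_ident scale) 1 = End_ident" "ev 1 (O_ident scale) (1 + 1) = 0"
      by (simp_all only: ev_O_ident) simp_all
    note eqs = this ev_sum_O_ident ident zero
    consider "r < i" | "r = i" | "i < r" "r \<le> m" | "r = m + 1" using r by linarith
    then show ?thesis
    proof cases
      case 2
      then have "r - i + 1 = 1" "\<not> r \<le> i - 1" "r \<le> i + 1 - 1" using i by auto
      then show ?thesis unfolding O_comp_basis_def by (simp only: eqs if_True if_False) (simp add: 2)
    next
      case 4
      then have "\<not> r \<le> i - 1" "\<not> r \<le> i + 1 - 1" "\<not> r \<le> m + 1 - 1" using i by auto
      then show ?thesis unfolding O_comp_basis_def by (simp only: eqs if_False add_0_left 4)
    qed (use i in \<open>auto simp: O_comp_basis_def eqs simp del: One_nat_def\<close>)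
  qed
  finally show "ev m (O_comp scale m 1 i f (O_ident scale)) r = ev m f r" by simp
qed

section \<open>Bilinearity of the composition and the operad axioms\<close>

lemma O_comp_basis_add_left:
  "O_comp_basis m n i (f + f') g r = O_comp_basis m n i f g r + O_comp_basis m n i f' g r"
  by (simp add: O_comp_basis_def ev_add insert_at_add_left del: plus_fun_apply)

text \<open>On the left additivity is pointwise; here it rests on additivity of the components of
  \<open>f\<close> in their input \<open>i\<close>, hence the membership hypothesis.\<close>

lemma O_comp_basis_add_right:
  "f \<in> O_A scale m \<Longrightarrow>
    O_comp_basis m n i f (g + g') r = O_comp_basis m n i f g r + O_comp_basis m n i f g' r"
  by (simp add: O_comp_basis_def ev_add ev_sum_add insert_at_add_right[OF ev_closed]
      del: plus_fun_apply)

lemma O_comp_basis_scale_left: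
  "O_comp_basis m n i (O_scale scale c f) g r = End_scale scale c (O_comp_basis m n i f g r)"
  by (simp add: O_comp_basis_def ev_scale[OF vector_space_axioms] insert_at_def End_scale_def
      scale_right_distrib fun_eq_iff)

lemma O_comp_basis_scale_right:
  assumes "f \<in> O_A scale m"
  shows "O_comp_basis m n i f (O_scale scale c g) r = End_scale scale c (O_comp_basis m n i f g r)"
proof -
  have "insert_at n i (ev m f q) (End_scale scale c u) = End_scale scale c (insert_at n i (ev m f q) u)" for q u
    using insert_at_scale_right[OF ev_closed[OF assms]] by (simp add: End_scale_def)
  then show ?thesis
    by (simp add: O_comp_basis_def ev_scale[OF vector_space_axioms] ev_sum_scale)
      (simp add: End_scale_def scale_right_distrib fun_eq_iff)
qed

lemma vector_space_O_scale: "vector_space (O_scale scale)"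
  by unfold_locales (simp_all add: O_scale_def fun_eq_iff scale_right_distrib scale_left_distrib)

lemma ns_operad_O: "ns_operad (O_scale scale) (O_A scale) (O_comp scale) (O_ident scale)"
proof -
  interpret O: vector_space "O_scale scale" by (fact vector_space_O_scale)
  show ?thesis
  proof unfold_locales
    show "O.subspace (O_A scale n)" for n
      unfolding O.subspace_def O_A_def O_scale_def
      using End_A_closed_zero End_A_closed_add End_A_closed_scale
      by (auto simp: scale_right_distrib zero_fun_def plus_fun_def ac_simps)
  next
    fix i m n :: nat and f f' g
    show "O_comp scale m n i (f + f') g = O_comp scale m n i f g + O_comp scale m n i f' g"
      by (simp add: O_comp_def fun_eq_iff O_comp_basis_add_left scale_right_distrib sum.distrib)
  next
    fix i m n :: nat and f g g'
    assume "f \<in> O_A scale m"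
    then show "O_comp scale m n i f (g + g') = O_comp scale m n i f g + O_comp scale m n i f g'"
      by (simp add: O_comp_def fun_eq_iff O_comp_basis_add_right scale_right_distrib sum.distrib)
  next
    fix i m n :: nat and f g c
    show "O_comp scale m n i (O_scale scale c f) g = O_scale scale c (O_comp scale m n i f g)"
      by (simp add: O_comp_def fun_eq_iff O_comp_basis_scale_left O_scale_def[of _ _ "O_comp _ _ _ _ _ _"]
          End_scale_def scale_sum_right mult.commute)
  next
    fix i m n :: nat and f g c
    assume "f \<in> O_A scale m"
    then show "O_comp scale m n i f (O_scale scale c g) = O_scale scale c (O_comp scale m n i f g)"
      by (simp add: O_comp_def fun_eq_iff O_comp_basis_scale_right O_scale_def[of _ _ "O_comp _ _ _ _ _ _"]
          End_scale_def scale_sum_right mult.commute)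
  qed (simp_all add: O_comp_closed O_comp_sequential O_comp_parallel O_ident_closed
      O_comp_ident_left O_comp_ident_right del: One_nat_def)
qed

end

section \<open>The morphism \<open>Theta\<close>\<close>

theorem theorem5p4:
  fixes scale :: "'k::field_char_0 \<Rightarrow> 'a::ab_group_add \<Rightarrow> 'a"
  assumes "vector_space scale"
  shows "ns_operad_morphism
           (O_scale scale) (O_A scale) (O_comp scale) (O_ident scale)
           (End_scale scale) (End_A scale) End_comp End_ident
           Theta"
proof -
  interpret vector_space scale by (fact assms)
  show ?thesis
  proof (rule ns_operad_morphism.intro[OF ns_operad_O ns_operad_End ns_operad_morphism_axioms.intro])
    \<comment> \<open>Both operads being in place, \<open>Theta_eq_ev_sum\<close> turns the
      remaining conditions into properties of \<open>ev_sum\<close>.\<close>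
    show "Theta (m + n - 1) (O_comp scale m n i f g) = End_comp m n i (Theta m f) (Theta n g)"
      if "1 \<le> i" "i \<le> m" "1 \<le> n" "f \<in> O_A scale m" "g \<in> O_A scale n" for i m n f g
      using that by (simp add: Theta_eq_ev_sum End_comp_def ev_sum_O_comp del: One_nat_def)
    show "Theta 1 (O_ident scale) = End_ident"
      using ev_sum_O_ident by (simp add: Theta_eq_ev_sum)
  qed (simp_all add: Theta_eq_ev_sum ev_sum_closed ev_sum_add ev_sum_scale
      del: plus_fun_apply One_nat_def)
qed

end
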